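(* Let $G$ be a finite group with $n=|G|$, and let $v(t)$, $t\in\mathbb{N}$, be a random walk on $G$ with step distribution $\gamma$ and uniform initial distribution. Fix, for each equivalence class of irreducible (complex) representations of $G$, one representative $\rho$; write $d_\rho$ for its degree. Suppose the following condition holds: for every function $J_n:G^n\to\mathbb{C}$, if \[ \sum_{\rho_1,\dots,\rho_n} d_{\rho_1}\cdots d_{\rho_n}\,\mathrm{Tr}\Big(\big(\hat\gamma(\rho_1)^{\ell_1}\otimes\cdots\otimes\hat\gamma(\rho_n)^{\ell_n}\big)\,\hat J_n(\rho_1\otimes\cdots\otimes\rho_n)\Big)=0 \] for all positive integers $\ell_1,\dots,\ell_n$ (where $\rho_1,\dots,\rho_n$ each range over all irreducible representations of $G$ up to equivalence), then $J_n(x_1,\dots,x_n)=0$ for all $x_1,\dots,x_n\in G$. Then $v(t)$ is reconstructive, i.e. any scenery $f$ can be reconstructed up to shifts from the distribution of $\{f(v(t))\}_{t=1}^\infty$.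
   Context: A scenery on a finite group $G$ is a function $f:G\to\{0,1\}$. A random walk on $G$ is defined by: $v(1)$ has some distribution, $Z_1,Z_2,\dots$ are i.i.d. random elements of $G$ independent of $v(1)$, and $v(t+1)=Z_t v(t)$ for $t\in\mathbb{N}$; its step distribution is $\gamma(s)=\mathbb{P}(Z_t=s)$. With $v(1)$ uniform on $G$, the walk is called reconstructive if, for any two sceneries $f_1,f_2$, the distributions of $\{f_1(v(t))\}_{t=1}^\infty$ and $\{f_2(v(t))\}_{t=1}^\infty$ are identical only if $f_1$ is a shift of $f_2$, i.e. there exists $g\in G$ with $f_1(k)=f_2(kg)$ for all $k\in G$. For a function $\phi$ on a finite group $H$ and a representation $\rho$ of $H$, the Fourier transform is $\hat\phi(\rho)=\sum_{s\in H}\phi(s)\rho(s)$. For $J_n:G^n\to\mathbb{C}$, $\hat J_n(\rho_1\otimes\cdots\otimes\rho_n)=\sum_{(x_1,\dots,x_n)\in G^n}J_n(x_1,\dots,x_n)\,\rho_1(x_1)\otimes\cdots\otimes\rho_n(x_n)$. *)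

theory Defs
  imports "HOL-Probability.Probability" "Jordan_Normal_Form.Matrix"
begin

text \<open>Groups are written additively (type class group_add, not assumed
commutative): the product k g of the paper is k + g, and v(t+1) = Z_t v(t)
is v(t+1) = Z_t + v(t). Time index 0 here corresponds to t = 1 in the paper.\<close>

primrec walk :: "'a::group_add \<Rightarrow> (nat \<Rightarrow> 'a) \<Rightarrow> nat \<Rightarrow> 'a" where
  "walk g z 0 = g"
| "walk g z (Suc t) = z t + walk g z t"

definition walk_space :: "'a::{group_add,finite} pmf \<Rightarrow> ('a \<times> (nat \<Rightarrow> 'a)) measure" where
  "walk_space \<gamma> = measure_pmf (pmf_of_set UNIV) \<Otimes>\<^sub>M (\<Pi>\<^sub>M i\<in>UNIV. measure_pmf \<gamma>)"

definition scenery_law :: "'a::{group_add,finite} pmf \<Rightarrow> ('a \<Rightarrow> bool) \<Rightarrow> (nat \<Rightarrow> bool) measure" where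
  "scenery_law \<gamma> f = distr (walk_space \<gamma>) (\<Pi>\<^sub>M i\<in>UNIV. count_space UNIV)
      (\<lambda>(g, z) t. f (walk g z t))"

definition is_shift :: "('a::group_add \<Rightarrow> bool) \<Rightarrow> ('a \<Rightarrow> bool) \<Rightarrow> bool" where
  "is_shift f1 f2 \<longleftrightarrow> (\<exists>g. \<forall>k. f1 k = f2 (k + g))"

definition reconstructive :: "'a::{group_add,finite} pmf \<Rightarrow> bool" where
  "reconstructive \<gamma> \<longleftrightarrow>
     (\<forall>f1 f2 :: 'a \<Rightarrow> bool. scenery_law \<gamma> f1 = scenery_law \<gamma> f2 \<longrightarrow> is_shift f1 f2)"

definition rep_deg :: "('a \<Rightarrow> complex mat) \<Rightarrow> nat" where
  "rep_deg \<rho> = dim_row (\<rho> undefined)"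

definition is_rep :: "('a::group_add \<Rightarrow> complex mat) \<Rightarrow> bool" where
  "is_rep \<rho> \<longleftrightarrow> (\<exists>d. (\<forall>x. \<rho> x \<in> carrier_mat d d) \<and> \<rho> 0 = 1\<^sub>m d \<and>
      (\<forall>x y. \<rho> (x + y) = \<rho> x * \<rho> y))"

definition invariant_subspace :: "('a \<Rightarrow> complex mat) \<Rightarrow> nat \<Rightarrow> complex vec set \<Rightarrow> bool" where
  "invariant_subspace \<rho> d W \<longleftrightarrow> W \<subseteq> carrier_vec d \<and> 0\<^sub>v d \<in> W \<and>
     (\<forall>u\<in>W. \<forall>w\<in>W. u + w \<in> W) \<and> (\<forall>c. \<forall>w\<in>W. c \<cdot>\<^sub>v w \<in> W) \<and>
     (\<forall>x. \<forall>w\<in>W. \<rho> x *\<^sub>v w \<in> W)"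

definition irreducible_rep :: "('a::group_add \<Rightarrow> complex mat) \<Rightarrow> bool" where
  "irreducible_rep \<rho> \<longleftrightarrow> is_rep \<rho> \<and> rep_deg \<rho> > 0 \<and>
     (\<forall>W. invariant_subspace \<rho> (rep_deg \<rho>) W \<longrightarrow> W = {0\<^sub>v (rep_deg \<rho>)} \<or> W = carrier_vec (rep_deg \<rho>))"

definition equiv_rep :: "('a \<Rightarrow> complex mat) \<Rightarrow> ('a \<Rightarrow> complex mat) \<Rightarrow> bool" where
  "equiv_rep \<rho> \<sigma> \<longleftrightarrow> rep_deg \<rho> = rep_deg \<sigma> \<and>
     (\<exists>P Q. P \<in> carrier_mat (rep_deg \<rho>) (rep_deg \<rho>) \<and> Q \<in> carrier_mat (rep_deg \<rho>) (rep_deg \<rho>) \<and>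
        P * Q = 1\<^sub>m (rep_deg \<rho>) \<and> Q * P = 1\<^sub>m (rep_deg \<rho>) \<and> (\<forall>x. \<sigma> x = P * \<rho> x * Q))"

definition complete_irreps :: "('a::group_add \<Rightarrow> complex mat) set \<Rightarrow> bool" where
  "complete_irreps R \<longleftrightarrow> (\<forall>\<rho>\<in>R. irreducible_rep \<rho>) \<and>
     (\<forall>\<rho>\<in>R. \<forall>\<sigma>\<in>R. equiv_rep \<rho> \<sigma> \<longrightarrow> \<rho> = \<sigma>) \<and>
     (\<forall>\<sigma>. irreducible_rep \<sigma> \<longrightarrow> (\<exists>\<rho>\<in>R. equiv_rep \<rho> \<sigma>))"

definition mtrace :: "complex mat \<Rightarrow> complex" where
  "mtrace A = (\<Sum>i<dim_row A. A $$ (i, i))"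

definition kron :: "complex mat \<Rightarrow> complex mat \<Rightarrow> complex mat" where
  "kron A B = mat (dim_row A * dim_row B) (dim_col A * dim_col B)
     (\<lambda>(i, j). A $$ (i div dim_row B, j div dim_col B) * B $$ (i mod dim_row B, j mod dim_col B))"

definition kron_list :: "complex mat list \<Rightarrow> complex mat" where
  "kron_list As = foldr kron As (1\<^sub>m 1)"

definition fourier_pmf :: "'a::finite pmf \<Rightarrow> ('a \<Rightarrow> complex mat) \<Rightarrow> complex mat" where
  "fourier_pmf \<gamma> \<rho> = mat (rep_deg \<rho>) (rep_deg \<rho>)
     (\<lambda>(i, j). \<Sum>s\<in>UNIV. complex_of_real (pmf \<gamma> s) * \<rho> s $$ (i, j))"

definition fourier_multi :: "nat \<Rightarrow> ((nat \<Rightarrow> 'a::finite) \<Rightarrow> complex) \<Rightarrow> (nat \<Rightarrow> 'a \<Rightarrow> complex mat) \<Rightarrow> complex mat" where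
  "fourier_multi n J \<rho>s = (let D = (\<Prod>i<n. rep_deg (\<rho>s i)) in
     mat D D (\<lambda>(i, j). \<Sum>x\<in>PiE {..<n} (\<lambda>_. UNIV).
        J x * kron_list (map (\<lambda>k. \<rho>s k (x k)) [0..<n]) $$ (i, j)))"

definition fourier_condition :: "'a::{group_add,finite} pmf \<Rightarrow> ('a \<Rightarrow> complex mat) set \<Rightarrow> bool" where
  "fourier_condition \<gamma> R \<longleftrightarrow> (let n = CARD('a) in
     \<forall>J :: (nat \<Rightarrow> 'a) \<Rightarrow> complex.
       (\<forall>l :: nat \<Rightarrow> nat. (\<forall>i<n. l i > 0) \<longrightarrow>
          (\<Sum>\<rho>s\<in>PiE {..<n} (\<lambda>_. R).
             (\<Prod>i<n. of_nat (rep_deg (\<rho>s i))) *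
             mtrace (kron_list (map (\<lambda>k. fourier_pmf \<gamma> (\<rho>s k) ^\<^sub>m l k) [0..<n])
                     * fourier_multi n J \<rho>s)) = 0)
       \<longrightarrow> (\<forall>x\<in>PiE {..<n} (\<lambda>_. UNIV). J x = 0))"

end

theory Submission
  imports Defs
begin

text \<open>
  Let \<open>F\<close> be the sum of \<open>d\<^sub>\<rho> \<chi>\<^sub>\<rho>\<close> over \<open>R\<close> and \<open>(T v)(s) = \<Sum>\<^sub>x F(s + x) v(x)\<close>. Tested on functions
  \<open>J(x) = \<Prod>\<^sub>i v(x\<^sub>i)\<close>, the Fourier condition says that \<open>v = 0\<close> as soon as \<open>T v\<close> is orthogonal to
  all convolution powers \<open>\<gamma>\<^sup>l\<close>, \<open>l > 0\<close>. In particular \<open>T\<close> is injective, hence surjective, so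
  only \<open>0\<close> is orthogonal to all \<open>\<gamma>\<^sup>l\<close>; the explicit form of \<open>F\<close>, that is, the Plancherel
  formula, is never needed.

  The law of the observed scenery determines the sum over \<open>g\<close> of the correlations
  \<open>f(g) f(s\<^sub>1 + g) f(s\<^sub>2 + s\<^sub>1 + g) \<dots>\<close> averaged over independent \<open>s\<^sub>i\<close> of law \<open>\<gamma>\<^bsup>l\<^sub>i\<^esup>\<close>. This is
  multilinear in the laws, so they can be replaced one at a time by point masses. Choosing the
  point masses such that \<open>g, s\<^sub>1 + g, \<dots>\<close> runs through a translate of the support of \<open>f\<^sub>1\<close> shows
  that this support has a right translate inside that of \<open>f\<^sub>2\<close>; by symmetry and counting the two
  supports are translates of each other.
\<close>

section \<open>Square linear systems with trivial kernel\<close>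

lemma ex_solution_of_trivial_kernel:
  fixes A :: "'a::finite \<Rightarrow> 'a \<Rightarrow> 'b::field"
  assumes "\<And>v. (\<And>i. (\<Sum>j\<in>UNIV. A i j * v j) = 0) \<Longrightarrow> v = (\<lambda>_. 0)"
  shows "\<exists>v. \<forall>i. (\<Sum>j\<in>UNIV. A i j * v j) = u i"
proof -
  define M where "M = (Finite_Cartesian_Product.vec_lambda
    (\<lambda>i. Finite_Cartesian_Product.vec_lambda (\<lambda>j. A i j)) :: 'b^'a^'a)"
  have mv: "Finite_Cartesian_Product.vec_nth (M *v x) i
      = (\<Sum>j\<in>UNIV. A i j * Finite_Cartesian_Product.vec_nth x j)" for x i
    by (simp add: M_def matrix_vector_mult_def)
  have "x = 0" if "M *v x = 0" for x
  proof -
    have "Finite_Cartesian_Product.vec_nth x = (\<lambda>_. 0)"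
      by (rule assms) (simp flip: mv add: that)
    then show ?thesis
      by (simp add: Finite_Cartesian_Product.vec_eq_iff)
  qed
  \<comment> \<open>A trivial kernel yields a left inverse \<open>B\<close>; for a square matrix it
    is also a right inverse, so \<open>B\<close> applied to \<open>u\<close> solves the
    system.\<close>
  then obtain B where "B ** M = Finite_Cartesian_Product.mat 1"
    using matrix_left_invertible_ker by metis
  then have MB: "M ** B = Finite_Cartesian_Product.mat 1"
    using matrix_left_right_inverse by metis
  define w where "w = B *v Finite_Cartesian_Product.vec_lambda u"
  have "M *v w = Finite_Cartesian_Product.vec_lambda u"
    by (simp add: w_def matrix_vector_mul_assoc MB)
  then have "(\<Sum>j\<in>UNIV. A i j * Finite_Cartesian_Product.vec_nth w j) = u i" for i
    by (simp flip: mv)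
  then show ?thesis
    by blast
qed

subsection \<open>The Fourier condition in terms of convolution powers\<close>

lemma mtrace_mult:
  assumes "A \<in> carrier_mat d d" "B \<in> carrier_mat d d"
  shows "mtrace (A * B) = (\<Sum>i<d. \<Sum>j<d. A $$ (i, j) * B $$ (j, i))"
  using assms by (auto simp: mtrace_def scalar_prod_def atLeast0LessThan intro!: sum.cong)

lemma kron_carrier:
  assumes "A \<in> carrier_mat a a" "B \<in> carrier_mat b b"
  shows "kron A B \<in> carrier_mat (a * b) (a * b)"
  using assms by (auto simp: kron_def)

text \<open>Every index below \<open>a * b\<close> is uniquely \<open>j + i * b\<close> with
  \<open>i < a\<close> and \<open>j < b\<close>. In these coordinates the entries of a Kronecker
  product factor, and the double sum expressing the trace splits into two.\<close>

lemma mtrace_kron_mult: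
  assumes A: "A \<in> carrier_mat a a" and A': "A' \<in> carrier_mat a a"
    and B: "B \<in> carrier_mat b b" and B': "B' \<in> carrier_mat b b"
  shows "mtrace (kron A B * kron A' B') = mtrace (A * A') * mtrace (B * B')"
proof -
  have less: "j + i * b < a * b" if "i < a" "j < b" for i j
  proof -
    have "j + i * b < Suc i * b" using that by simp
    also have "\<dots> \<le> a * b" using that by (intro mult_le_mono1) simp
    finally show ?thesis .
  qed
  have "mtrace (kron A B * kron A' B')
      = (\<Sum>i<a*b. \<Sum>j<a*b. kron A B $$ (i, j) * kron A' B' $$ (j, i))"
    using assms by (intro mtrace_mult kron_carrier)
  also have "\<dots> = (\<Sum>i<a. \<Sum>i'<b. \<Sum>j<a. \<Sum>j'<b.
      (A $$ (i, j) * B $$ (i', j')) * (A' $$ (j, i) * B' $$ (j', i')))"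
    using assms by (auto simp: sum_mult_product kron_def less intro!: sum.cong)
  also have "\<dots> = (\<Sum>i<a. \<Sum>j<a. A $$ (i, j) * A' $$ (j, i)) *
      (\<Sum>i'<b. \<Sum>j'<b. B $$ (i', j') * B' $$ (j', i'))"
    by (subst sum.swap[of _ "{..<a}" "{..<b}"])
      (simp add: sum_distrib_left sum_distrib_right mult_ac sum.swap[of _ "{..<a}" "{..<b}"])
  finally show ?thesis
    using assms by (simp add: mtrace_mult)
qed

lemma kron_list_carrier:
  assumes "\<And>k. k \<in> set ks \<Longrightarrow> A k \<in> carrier_mat (d k) (d k)"
  shows "kron_list (map A ks) \<in> carrier_mat (\<Prod>k\<leftarrow>ks. d k) (\<Prod>k\<leftarrow>ks. d k)"
  using assms by (induction ks) (auto simp: kron_list_def intro: kron_carrier)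

lemma mtrace_kron_list_mult:
  assumes "\<And>k. k \<in> set ks \<Longrightarrow> A k \<in> carrier_mat (d k) (d k)"
    and "\<And>k. k \<in> set ks \<Longrightarrow> B k \<in> carrier_mat (d k) (d k)"
  shows "mtrace (kron_list (map A ks) * kron_list (map B ks)) = (\<Prod>k\<leftarrow>ks. mtrace (A k * B k))"
  using assms
proof (induction ks)
  case Nil
  then show ?case by (simp add: kron_list_def mtrace_def)
next
  case (Cons k ks)
  have eq: "kron_list (map X (k # ks)) = kron (X k) (kron_list (map X ks))" for X
    by (simp add: kron_list_def)
  show ?case
    unfolding eq using Cons
    by (subst mtrace_kron_mult[OF _ _ kron_list_carrier kron_list_carrier]) auto
qed

text \<open>The \<open>l\<close>-fold convolution power of \<gamma>: the law of the displacement
  after \<open>l\<close> steps. The first step \<open>r\<close> is the rightmost summand, since the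
  walk adds later steps on the left.\<close>

primrec step_pow :: "'a::{group_add,finite} pmf \<Rightarrow> nat \<Rightarrow> 'a \<Rightarrow> real" where
  "step_pow \<gamma> 0 s = of_bool (s = 0)"
| "step_pow \<gamma> (Suc l) s = (\<Sum>r\<in>UNIV. pmf \<gamma> r * step_pow \<gamma> l (s - r))"

lemma sum_step_pow_0:
  fixes h :: "'a::{group_add,finite} \<Rightarrow> 'b::real_vector"
  shows "(\<Sum>s\<in>UNIV. step_pow \<gamma> 0 s *\<^sub>R h s) = h 0"
proof -
  have "step_pow \<gamma> 0 s *\<^sub>R h s = (if s = 0 then h s else 0)" for s
    by simp
  then show ?thesis by simp
qed

lemma sum_step_pow_Suc:
  fixes h :: "'a::{group_add,finite} \<Rightarrow> 'b::real_vector"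
  shows "(\<Sum>s\<in>UNIV. step_pow \<gamma> (Suc l) s *\<^sub>R h s)
    = (\<Sum>r\<in>UNIV. pmf \<gamma> r *\<^sub>R (\<Sum>s\<in>UNIV. step_pow \<gamma> l s *\<^sub>R h (s + r)))"
proof -
  have "(\<Sum>s\<in>UNIV. step_pow \<gamma> l s *\<^sub>R h (s + r)) = (\<Sum>s\<in>UNIV. step_pow \<gamma> l (s - r) *\<^sub>R h s)" for r
    by (rule sum.reindex_bij_witness[of _ "\<lambda>s. s - r" "\<lambda>s. s + r"]) auto
  then have "(\<Sum>r\<in>UNIV. pmf \<gamma> r *\<^sub>R (\<Sum>s\<in>UNIV. step_pow \<gamma> l s *\<^sub>R h (s + r)))
      = (\<Sum>r\<in>UNIV. \<Sum>s\<in>UNIV. (pmf \<gamma> r * step_pow \<gamma> l (s - r)) *\<^sub>R h s)"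
    by (simp only: scaleR_sum_right scaleR_scaleR)
  then show ?thesis
    by (simp add: scaleR_sum_left) (rule sum.swap)
qed

section \<open>Fourier transforms of convolution powers\<close>

lemma is_rep_carrier:
  assumes "is_rep \<rho>"
  shows "\<rho> x \<in> carrier_mat (rep_deg \<rho>) (rep_deg \<rho>)"
  using assms unfolding is_rep_def rep_deg_def by (metis carrier_matD(1))

text \<open>Multiplicativity of \<rho> turns convolution into matrix multiplication. The matrix
  power splits off its factor on the right, matching the position of \<open>r\<close> in
  \<open>step_pow\<close>.\<close>

lemma fourier_pmf_power:
  assumes rep: "is_rep \<rho>"
  shows "fourier_pmf \<gamma> \<rho> ^\<^sub>m l
    = mat (rep_deg \<rho>) (rep_deg \<rho>) (\<lambda>(i, j). \<Sum>s\<in>UNIV. step_pow \<gamma> l s *\<^sub>R \<rho> s $$ (i, j))"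
proof (induction l)
  case 0
  have "\<rho> 0 = 1\<^sub>m (rep_deg \<rho>)"
    using rep unfolding is_rep_def rep_deg_def by (metis carrier_matD(1))
  then show ?case
    by (auto simp: sum_step_pow_0 fourier_pmf_def simp del: step_pow.simps)
next
  case (Suc l)
  have mult: "(\<Sum>k<rep_deg \<rho>. \<rho> s $$ (i, k) * \<rho> r $$ (k, j)) = \<rho> (s + r) $$ (i, j)"
    if "i < rep_deg \<rho>" "j < rep_deg \<rho>" for s r i j
  proof -
    have "\<rho> (s + r) = \<rho> s * \<rho> r"
      using rep unfolding is_rep_def by blast
    then show ?thesis
      using is_rep_carrier[OF rep, of s] is_rep_carrier[OF rep, of r] that
      by (simp add: scalar_prod_def atLeast0LessThan)
  qed
  have "(\<Sum>k<rep_deg \<rho>. (\<Sum>s\<in>UNIV. step_pow \<gamma> l s *\<^sub>R \<rho> s $$ (i, k)) *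
         (\<Sum>r\<in>UNIV. complex_of_real (pmf \<gamma> r) * \<rho> r $$ (k, j)))
       = (\<Sum>s\<in>UNIV. step_pow \<gamma> (Suc l) s *\<^sub>R \<rho> s $$ (i, j))" (is "?L = _")
    if "i < rep_deg \<rho>" "j < rep_deg \<rho>" for i j
  proof -
    have "?L = (\<Sum>k<rep_deg \<rho>. \<Sum>r\<in>UNIV. \<Sum>s\<in>UNIV.
        pmf \<gamma> r *\<^sub>R step_pow \<gamma> l s *\<^sub>R (\<rho> s $$ (i, k) * \<rho> r $$ (k, j)))"
      by (subst sum_product, subst sum.swap) (simp add: scaleR_conv_of_real mult_ac)
    also have "\<dots> = (\<Sum>r\<in>UNIV. \<Sum>s\<in>UNIV. \<Sum>k<rep_deg \<rho>.
        pmf \<gamma> r *\<^sub>R step_pow \<gamma> l s *\<^sub>R (\<rho> s $$ (i, k) * \<rho> r $$ (k, j)))"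
      by (subst sum.swap, rule sum.cong[OF refl], rule sum.swap)
    also have "\<dots> = (\<Sum>s\<in>UNIV. step_pow \<gamma> (Suc l) s *\<^sub>R \<rho> s $$ (i, j))"
      by (simp only: sum_step_pow_Suc mult[OF that] flip: scaleR_sum_right)
    finally show ?thesis .
  qed
  then show ?case
    unfolding pow_mat.simps Suc unfolding fourier_pmf_def
    by (auto simp: scalar_prod_def atLeast0LessThan simp del: step_pow.simps intro!: eq_matI)
qed

lemma mtrace_fourier_pmf_power_mult:
  assumes rep: "is_rep \<rho>"
  shows "mtrace (fourier_pmf \<gamma> \<rho> ^\<^sub>m l * \<rho> x) = (\<Sum>s\<in>UNIV. step_pow \<gamma> l s *\<^sub>R mtrace (\<rho> (s + x)))"
proof -
  have mult: "mtrace (\<rho> (s + x)) = (\<Sum>i<rep_deg \<rho>. \<Sum>j<rep_deg \<rho>. \<rho> s $$ (i, j) * \<rho> x $$ (j, i))" for s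
  proof -
    have "\<rho> (s + x) = \<rho> s * \<rho> x"
      using rep unfolding is_rep_def by blast
    then show ?thesis
      by (simp add: mtrace_mult[OF is_rep_carrier[OF rep] is_rep_carrier[OF rep]])
  qed
  have "mtrace (fourier_pmf \<gamma> \<rho> ^\<^sub>m l * \<rho> x) = (\<Sum>i<rep_deg \<rho>. \<Sum>j<rep_deg \<rho>.
       \<Sum>s\<in>UNIV. step_pow \<gamma> l s *\<^sub>R (\<rho> s $$ (i, j) * \<rho> x $$ (j, i)))"
    unfolding fourier_pmf_power[OF rep]
    by (subst mtrace_mult[OF _ is_rep_carrier[OF rep]]) (auto simp: sum_distrib_right)
  also have "\<dots> = (\<Sum>s\<in>UNIV. step_pow \<gamma> l s *\<^sub>R mtrace (\<rho> (s + x)))"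
    unfolding mult scaleR_sum_right
    by (subst (2) sum.swap, subst (1) sum.swap) rule
  finally show ?thesis .
qed

text \<open>\<open>fourier_multi\<close> is a linear combination of Kronecker products with
  coefficients \<open>J x\<close>; the trace is linear, and on a product of two Kronecker products
  it factors over the coordinates.\<close>

lemma mtrace_mult_fourier_multi:
  assumes rep: "\<And>k. k < n \<Longrightarrow> is_rep (\<rho>s k)"
    and A: "\<And>k. k < n \<Longrightarrow> A k \<in> carrier_mat (rep_deg (\<rho>s k)) (rep_deg (\<rho>s k))"
  shows "mtrace (kron_list (map A [0..<n]) * fourier_multi n J \<rho>s)
    = (\<Sum>x\<in>PiE {..<n} (\<lambda>_. UNIV). J x * (\<Prod>k<n. mtrace (A k * \<rho>s k (x k))))"
proof -
  define D where "D = (\<Prod>i<n. rep_deg (\<rho>s i))"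
  have D: "D = (\<Prod>k\<leftarrow>[0..<n]. rep_deg (\<rho>s k))"
    by (simp add: D_def prod.list_conv_set_nth atLeast0LessThan)
  define K where "K x = kron_list (map (\<lambda>k. \<rho>s k (x k)) [0..<n])" for x
  have K: "K x \<in> carrier_mat D D" for x
    unfolding K_def D by (rule kron_list_carrier) (auto intro: is_rep_carrier rep)
  have M: "kron_list (map A [0..<n]) \<in> carrier_mat D D" (is "?M \<in> _")
    unfolding D by (rule kron_list_carrier) (auto intro: A)
  have fm: "fourier_multi n J \<rho>s
      = mat D D (\<lambda>(i, j). \<Sum>x\<in>PiE {..<n} (\<lambda>_. UNIV). J x * K x $$ (i, j))"
    by (simp add: fourier_multi_def D_def K_def Let_def)
  have "mtrace (?M * fourier_multi n J \<rho>s)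
      = (\<Sum>i<D. \<Sum>j<D. \<Sum>x\<in>PiE {..<n} (\<lambda>_. UNIV). J x * (?M $$ (i, j) * K x $$ (j, i)))"
    unfolding fm by (subst mtrace_mult[OF M]) (auto simp: sum_distrib_left mult_ac)
  also have "\<dots> = (\<Sum>x\<in>PiE {..<n} (\<lambda>_. UNIV). J x * mtrace (?M * K x))"
    unfolding mtrace_mult[OF M K] sum_distrib_left
    by (subst (2) sum.swap, subst (1) sum.swap) rule
  also have "\<dots> = (\<Sum>x\<in>PiE {..<n} (\<lambda>_. UNIV). J x * (\<Prod>k<n. mtrace (A k * \<rho>s k (x k))))"
  proof (intro sum.cong refl arg_cong2[of _ _ _ _ "(*)"])
    fix x
    show "mtrace (?M * K x) = (\<Prod>k<n. mtrace (A k * \<rho>s k (x k)))"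
    unfolding K_def
    by (subst mtrace_kron_list_mult[where d = "\<lambda>k. rep_deg (\<rho>s k)"])
      (auto simp: prod.list_conv_set_nth atLeast0LessThan intro: A is_rep_carrier rep)
  qed
  finally show ?thesis .
qed

section \<open>Separation of functions by convolution powers\<close>

lemma fourier_condition_step_pow:
  fixes \<gamma> :: "'a::{group_add,finite} pmf"
  assumes rep: "\<And>\<rho>. \<rho> \<in> R \<Longrightarrow> is_rep \<rho>"
    and cond: "fourier_condition \<gamma> R"
  obtains F :: "'a \<Rightarrow> complex" where
    "\<And>v. (\<And>l. l > 0 \<Longrightarrow> (\<Sum>s\<in>UNIV. step_pow \<gamma> l s *\<^sub>R (\<Sum>x\<in>UNIV. F (s + x) * v x)) = 0)
      \<Longrightarrow> v = (\<lambda>_. 0)"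
proof
  define n where "n = CARD('a)"
  have n: "n > 0" by (simp add: n_def)
  define S where "S J l = (\<Sum>\<rho>s\<in>PiE {..<n} (\<lambda>_. R).
             (\<Prod>i<n. of_nat (rep_deg (\<rho>s i))) *
             mtrace (kron_list (map (\<lambda>k. fourier_pmf \<gamma> (\<rho>s k) ^\<^sub>m l k) [0..<n])
                     * fourier_multi n J \<rho>s))" for J l
  have cond': "J x = 0" if "\<And>l. (\<And>i. i < n \<Longrightarrow> l i > 0) \<Longrightarrow> S J l = 0"
    "x \<in> PiE {..<n} (\<lambda>_. UNIV)" for J x
    using cond that unfolding fourier_condition_def Let_def n_def S_def by blast
  \<comment> \<open>A sum over an infinite set is 0 by default. An infinite \<open>R\<close> would
    thus make the premise of the condition hold for every \<open>J\<close>, even for the constant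
    1.\<close>
  have "finite R"
  proof (rule ccontr)
    assume inf: "infinite R"
    have "R \<subseteq> (\<lambda>\<rho>s. \<rho>s 0) ` PiE {..<n} (\<lambda>_. R)"
    proof
      fix \<rho> assume "\<rho> \<in> R"
      then have "restrict (\<lambda>_. \<rho>) {..<n} \<in> PiE {..<n} (\<lambda>_. R)" by auto
      then show "\<rho> \<in> (\<lambda>\<rho>s. \<rho>s 0) ` PiE {..<n} (\<lambda>_. R)"
        using n by (intro image_eqI[of _ _ "restrict (\<lambda>_. \<rho>) {..<n}"]) auto
    qed
    with inf have "infinite (PiE {..<n} (\<lambda>_. R))"
      using finite_surj by blast
    then have "S (\<lambda>_. 1) l = 0" for l
      by (simp add: S_def)
    from cond'[OF this, of "restrict (\<lambda>_. 0) {..<n}"] show False by auto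
  qed
  define F where "F g = (\<Sum>\<rho>\<in>R. of_nat (rep_deg \<rho>) * mtrace (\<rho> g))" for g
  fix v :: "'a \<Rightarrow> complex"
  assume v: "\<And>l. l > 0 \<Longrightarrow> (\<Sum>s\<in>UNIV. step_pow \<gamma> l s *\<^sub>R (\<Sum>x\<in>UNIV. F (s + x) * v x)) = 0"
  \<comment> \<open>For a function of product form, the sum over tuples of representations becomes a
    product over the coordinates.\<close>
  define J where "J x = (\<Prod>k<n. v (x k))" for x
  have "S J l = 0" if l: "\<And>i. i < n \<Longrightarrow> l i > 0" for l
  proof -
    let ?t = "\<lambda>k \<rho> x. mtrace (fourier_pmf \<gamma> \<rho> ^\<^sub>m l k * \<rho> x)"
    have multi: "mtrace (kron_list (map (\<lambda>k. fourier_pmf \<gamma> (\<rho>s k) ^\<^sub>m l k) [0..<n]) * fourier_multi n J \<rho>s)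
        = (\<Prod>k<n. \<Sum>x\<in>UNIV. v x * ?t k (\<rho>s k) x)"
      if "\<rho>s \<in> PiE {..<n} (\<lambda>_. R)" for \<rho>s
    proof -
      have "mtrace (kron_list (map (\<lambda>k. fourier_pmf \<gamma> (\<rho>s k) ^\<^sub>m l k) [0..<n]) * fourier_multi n J \<rho>s)
          = (\<Sum>x\<in>PiE {..<n} (\<lambda>_. UNIV). J x * (\<Prod>k<n. ?t k (\<rho>s k) (x k)))"
      proof (rule mtrace_mult_fourier_multi)
        fix k assume "k < n"
        with that show "is_rep (\<rho>s k)" by (auto intro: rep)
        then show "fourier_pmf \<gamma> (\<rho>s k) ^\<^sub>m l k \<in> carrier_mat (rep_deg (\<rho>s k)) (rep_deg (\<rho>s k))"
          by (simp add: fourier_pmf_power)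
      qed
      also have "\<dots> = (\<Sum>x\<in>PiE {..<n} (\<lambda>_. UNIV). \<Prod>k<n. v (x k) * ?t k (\<rho>s k) (x k))"
        by (simp only: J_def prod.distrib)
      also have "\<dots> = (\<Prod>k<n. \<Sum>x\<in>UNIV. v x * ?t k (\<rho>s k) x)"
        by (rule prod_sum_PiE[symmetric]) auto
      finally show ?thesis .
    qed
    \<comment> \<open>Summing over \<open>R\<close> in one coordinate assembles the characters into
      \<open>F\<close>; what remains is the pairing that \<open>v\<close> makes zero.\<close>
    have site: "(\<Sum>\<rho>\<in>R. of_nat (rep_deg \<rho>) * (\<Sum>x\<in>UNIV. v x * ?t k \<rho> x))
        = (\<Sum>s\<in>UNIV. step_pow \<gamma> (l k) s *\<^sub>R (\<Sum>x\<in>UNIV. F (s + x) * v x))" for k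
    proof -
      have "(\<Sum>\<rho>\<in>R. of_nat (rep_deg \<rho>) * (\<Sum>x\<in>UNIV. v x * ?t k \<rho> x))
         = (\<Sum>\<rho>\<in>R. \<Sum>x\<in>UNIV. \<Sum>s\<in>UNIV. step_pow \<gamma> (l k) s *\<^sub>R
              (of_nat (rep_deg \<rho>) * mtrace (\<rho> (s + x)) * v x))"
        by (auto simp: mtrace_fourier_pmf_power_mult rep sum_distrib_left mult_ac intro!: sum.cong)
      also have "\<dots> = (\<Sum>s\<in>UNIV. \<Sum>x\<in>UNIV. \<Sum>\<rho>\<in>R. step_pow \<gamma> (l k) s *\<^sub>R
              (of_nat (rep_deg \<rho>) * mtrace (\<rho> (s + x)) * v x))"
        by (subst sum.swap, subst (2) sum.swap, subst (1) sum.swap) rule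
      finally show ?thesis
        by (simp add: F_def sum_distrib_right scaleR_sum_right)
    qed
    have "S J l = (\<Sum>\<rho>s\<in>PiE {..<n} (\<lambda>_. R).
        \<Prod>k<n. of_nat (rep_deg (\<rho>s k)) * (\<Sum>x\<in>UNIV. v x * ?t k (\<rho>s k) x))"
      by (simp only: S_def prod.distrib multi cong: sum.cong)
    also have "\<dots> = (\<Prod>k<n. \<Sum>\<rho>\<in>R. of_nat (rep_deg \<rho>) * (\<Sum>x\<in>UNIV. v x * ?t k \<rho> x))"
      using \<open>finite R\<close> by (simp add: prod_sum_PiE)
    \<comment> \<open>All factors vanish, and there is at least one because
      \<open>n > 0\<close>.\<close>
    finally show ?thesis
      using l n v by (simp add: site)
  qed
  \<comment> \<open>At a constant tuple, \<open>J\<close> is the \<open>n\<close>-th power of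
    \<open>v x\<close>.\<close>
  from cond'[OF this] have "J (restrict (\<lambda>_. x) {..<n}) = 0" for x
    by auto
  then have "v x = 0" for x
    by (simp add: J_def)
  then show "v = (\<lambda>_. 0)" by auto
qed

text \<open>Once \<open>u\<close> is written as the image of some \<open>v\<close> under the kernel
  \<open>F (s + x)\<close>, its orthogonality to the powers forces \<open>v = 0\<close>, and hence
  \<open>u = 0\<close>.\<close>

lemma step_pow_separating:
  fixes \<gamma> :: "'a::{group_add,finite} pmf" and u :: "'a \<Rightarrow> real"
  assumes rep: "\<And>\<rho>. \<rho> \<in> R \<Longrightarrow> is_rep \<rho>"
    and cond: "fourier_condition \<gamma> R"
    and u: "\<And>l. l > 0 \<Longrightarrow> (\<Sum>s\<in>UNIV. step_pow \<gamma> l s * u s) = 0"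
  shows "u x = 0"
proof -
  obtain F :: "'a \<Rightarrow> complex" where F: "\<And>v. (\<And>l. l > 0 \<Longrightarrow>
      (\<Sum>s\<in>UNIV. step_pow \<gamma> l s *\<^sub>R (\<Sum>x\<in>UNIV. F (s + x) * v x)) = 0) \<Longrightarrow> v = (\<lambda>_. 0)"
    using fourier_condition_step_pow[OF rep cond] by blast
  have "\<exists>v. \<forall>s. (\<Sum>x\<in>UNIV. F (s + x) * v x) = complex_of_real (u s)"
    \<comment> \<open>If the image of \<open>v\<close> is 0, it is orthogonal to all powers, so
      \<open>F\<close> gives the trivial kernel.\<close>
    by (rule ex_solution_of_trivial_kernel) (rule F, simp)
  then obtain v where v: "\<And>s. (\<Sum>x\<in>UNIV. F (s + x) * v x) = complex_of_real (u s)"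
    by blast
  have "v = (\<lambda>_. 0)"
  proof (rule F)
    fix l :: nat assume "l > 0"
    have "(\<Sum>s\<in>UNIV. step_pow \<gamma> l s *\<^sub>R complex_of_real (u s))
        = complex_of_real (\<Sum>s\<in>UNIV. step_pow \<gamma> l s * u s)"
      by (simp add: scaleR_conv_of_real)
    then show "(\<Sum>s\<in>UNIV. step_pow \<gamma> l s *\<^sub>R (\<Sum>x\<in>UNIV. F (s + x) * v x)) = 0"
      using u[OF \<open>l > 0\<close>] by (simp add: v)
  qed
  with v[of x] show ?thesis by simp
qed

subsection \<open>Correlations of a scenery\<close>

primrec correlation :: "('a::{group_add,finite} \<Rightarrow> bool) \<Rightarrow> ('a \<Rightarrow> real) list \<Rightarrow> 'a \<Rightarrow> real" where
  "correlation f [] g = of_bool (f g)"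
| "correlation f (w # ws) g = of_bool (f g) * (\<Sum>s\<in>UNIV. w s * correlation f ws (s + g))"

abbreviation point_weight :: "'a \<Rightarrow> 'a \<Rightarrow> real" where
  "point_weight x \<equiv> (\<lambda>s. of_bool (s = x))"

lemma sum_point_weight:
  "(\<Sum>s\<in>UNIV. point_weight x s * h s) = h (x::'a::finite)"
proof -
  have "point_weight x s * h s = (if s = x then h s else 0)" for s
    by simp
  then show ?thesis by simp
qed

text \<open>Linearity in a single slot: \<open>w\<close> is the combination of point masses with
  coefficients \<open>w s\<close>.\<close>

lemma correlation_expand:
  "(\<Sum>s\<in>UNIV. w s * correlation f (us @ point_weight s # ws) g) = correlation f (us @ w # ws) g"
proof (induction us arbitrary: g)
  case Nil
  then show ?case
    by (simp add: sum_point_weight sum_distrib_left mult_ac)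
next
  case (Cons u us)
  have "(\<Sum>s\<in>UNIV. w s * correlation f ((u # us) @ point_weight s # ws) g)
      = (\<Sum>r\<in>UNIV. of_bool (f g) * (u r * (\<Sum>s\<in>UNIV. w s * correlation f (us @ point_weight s # ws) (r + g))))"
    unfolding append_Cons correlation.simps sum_distrib_left
    by (subst sum.swap) (simp only: mult_ac)
  then show ?case
    by (simp only: Cons append_Cons correlation.simps sum_distrib_left)
qed

text \<open>Slots are converted from left to right. With a variable point mass in the next slot, the
  difference of the two sums is a function of its position that every \<open>w\<close> in
  \<open>W\<close> annihilates, by the induction hypothesis for \<open>w # ws\<close>; so it is
  zero.\<close>

lemma correlation_point_weights:
  assumes separating: "\<And>u :: 'a::{group_add,finite} \<Rightarrow> real.
      (\<And>w. w \<in> W \<Longrightarrow> (\<Sum>s\<in>UNIV. w s * u s) = 0) \<Longrightarrow> u = (\<lambda>_. 0)"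
    and eq: "\<And>ws. set ws \<subseteq> W \<Longrightarrow>
      (\<Sum>g\<in>UNIV. correlation f1 ws g) = (\<Sum>g\<in>UNIV. correlation f2 ws g)"
    and ws: "set ws \<subseteq> W"
  shows "(\<Sum>g\<in>UNIV. correlation f1 (map point_weight xs @ ws) g)
    = (\<Sum>g\<in>UNIV. correlation f2 (map point_weight xs @ ws) g)"
  using ws
proof (induction xs arbitrary: ws rule: rev_induct)
  case Nil
  then show ?case by (simp add: eq)
next
  case (snoc x xs)
  define c where "c f s = (\<Sum>g\<in>UNIV. correlation f (map point_weight xs @ point_weight s # ws) g)" for f s
  have c: "(\<Sum>s\<in>UNIV. w s * c f s) = (\<Sum>g\<in>UNIV. correlation f (map point_weight xs @ w # ws) g)" for f w
    unfolding c_def sum_distrib_left by (subst sum.swap) (simp only: correlation_expand)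
  have "(\<lambda>s. c f1 s - c f2 s) = (\<lambda>_. 0)"
  proof (rule separating)
    fix w assume "w \<in> W"
    then show "(\<Sum>s\<in>UNIV. w s * (c f1 s - c f2 s)) = 0"
      using snoc.IH[of "w # ws"] snoc.prems by (simp add: right_diff_distrib sum_subtractf c)
  qed
  then have "c f1 x = c f2 x"
    by (metis eq_iff_diff_eq_0)
  then show ?case
    by (simp add: c_def)
qed

section \<open>Point masses and translates of supports\<close>

primrec increments :: "'a::group_add \<Rightarrow> 'a list \<Rightarrow> 'a list" where
  "increments y [] = []"
| "increments y (x # xs) = (x - y) # increments x xs"

text \<open>Adding the increments on the left leads from \<open>y\<close> through \<open>xs\<close>.
  Started at \<open>g\<close> instead, the same increments visit the right translates by
  \<open>- y + g\<close>, since the differences telescope.\<close>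

lemma correlation_increments:
  "correlation f (map point_weight (increments y xs)) g
    = of_bool (\<forall>x\<in>set (y # xs). f (x - y + g))"
proof (induction xs arbitrary: y g)
  case Nil
  then show ?case by simp
next
  case (Cons x xs)
  have "x' - x + (x - y + g) = x' - y + g" for x'
    by (simp add: algebra_simps flip: add.assoc)
  then show ?case
    by (simp add: Cons sum_point_weight)
qed

lemma correlation_imp_translate:
  fixes f1 f2 :: "'a::{group_add,finite} \<Rightarrow> bool"
  assumes eq: "\<And>xs. (\<Sum>g\<in>UNIV. correlation f1 (map point_weight xs) g)
      = (\<Sum>g\<in>UNIV. correlation f2 (map point_weight xs) g)"
  shows "\<exists>h. \<forall>k. f1 k \<longrightarrow> f2 (k + h)"
proof (cases "\<exists>y. f1 y")
  case False
  then show ?thesis by auto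
next
  case True
  then obtain y where y: "f1 y" by blast
  obtain xs where xs: "set xs = {x. f1 x}"
    using finite_list[of "{x. f1 x}"] by auto
  let ?c = "\<lambda>f. correlation f (map point_weight (increments y xs))"
  have nonneg: "?c f g \<ge> 0" for f g
    unfolding correlation_increments by simp
  \<comment> \<open>For \<open>g = y\<close> the translation is trivial, and the visited points are
    exactly the support of \<open>f1\<close>.\<close>
  have "?c f1 y = 1"
    using y by (simp add: correlation_increments xs)
  then have "(\<Sum>g\<in>UNIV. ?c f1 g) > 0"
    using nonneg by (intro sum_pos2[of _ y]) auto
  then have "(\<Sum>g\<in>UNIV. ?c f2 g) \<noteq> 0"
    unfolding eq by simp
  then obtain g where "?c f2 g \<noteq> 0"
    by (rule sum.not_neutral_contains_not_neutral)
  then have "\<forall>x\<in>set (y # xs). f2 (x - y + g)"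
    unfolding correlation_increments by simp
  then have "f1 k \<longrightarrow> f2 (k + (- y + g))" for k
    by (auto simp: xs add.assoc[symmetric])
  then show ?thesis by blast
qed

text \<open>Translations are injective, so the two inclusions give supports of equal size; an
  inclusion between finite sets of equal size is an equality.\<close>

lemma is_shift_of_translates:
  fixes f1 f2 :: "'a::{group_add,finite} \<Rightarrow> bool"
  assumes "\<forall>k. f1 k \<longrightarrow> f2 (k + h)" "\<forall>k. f2 k \<longrightarrow> f1 (k + h')"
  shows "is_shift f1 f2"
proof -
  have le: "card {k. f k} \<le> card {k. f' k}" if "\<forall>k. f k \<longrightarrow> f' (k + a)"
    for f f' :: "'a \<Rightarrow> bool" and a
    using that by (intro card_inj_on_le[of "\<lambda>k. k + a"]) (auto simp: inj_on_def)
  have "(\<lambda>k. k + h) ` {k. f1 k} = {k. f2 k}"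
  proof (rule card_subset_eq)
    show "card ((\<lambda>k. k + h) ` {k. f1 k}) = card {k. f2 k}"
      using le[OF assms(1)] le[OF assms(2)] by (simp add: card_image inj_on_def)
  qed (use assms in auto)
  then have "f2 (k + h) \<longleftrightarrow> k + h \<in> (\<lambda>k. k + h) ` {k. f1 k}" for k
    by simp
  then have "f1 k = f2 (k + h)" for k
    by auto
  then show ?thesis
    unfolding is_shift_def by blast
qed

subsection \<open>Observing the scenery along the walk\<close>

text \<open>\<^term>\<open>bs\<close> marks the times at which the scenery is required to be \<^term>\<open>True\<close>.\<close>

definition visible :: "('a::group_add \<Rightarrow> bool) \<Rightarrow> bool list \<Rightarrow> 'a \<Rightarrow> (nat \<Rightarrow> 'a) \<Rightarrow> bool" where
  "visible f bs g z \<longleftrightarrow> (\<forall>t<length bs. bs ! t \<longrightarrow> f (walk g z t))"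

abbreviation step_space :: "'a pmf \<Rightarrow> (nat \<Rightarrow> 'a) measure" where
  "step_space \<gamma> \<equiv> \<Pi>\<^sub>M i\<in>UNIV. measure_pmf \<gamma>"

definition visible_prob :: "'a::{group_add,finite} pmf \<Rightarrow> ('a \<Rightarrow> bool) \<Rightarrow> bool list \<Rightarrow> 'a \<Rightarrow> real" where
  "visible_prob \<gamma> f bs g = measure (step_space \<gamma>) {z. visible f bs g z}"

text \<open>Later steps are added on the left, so the first step can be absorbed into the starting
  point.\<close>

lemma walk_case_nat: "walk g (case_nat s z) (Suc t) = walk (s + g) z t"
  by (induction t) auto

lemma visible_Cons_case_nat:
  "visible f (b # bs) g (case_nat s z) \<longleftrightarrow> (b \<longrightarrow> f g) \<and> visible f bs (s + g) z"
  unfolding visible_def length_Cons All_less_Suc2 nth_Cons_Suc walk_case_nat by simp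

lemma space_step_space [simp]: "space (step_space \<gamma>) = UNIV"
  by (simp add: space_PiM)

lemma measurable_walk:
  "(\<lambda>z. walk g z t) \<in> step_space (\<gamma> :: 'a::{group_add,finite} pmf) \<rightarrow>\<^sub>M count_space UNIV"
proof (induction t)
  case (Suc t)
  have "(\<lambda>z. z t) \<in> step_space \<gamma> \<rightarrow>\<^sub>M measure_pmf \<gamma>"
    by (rule measurable_component_singleton) simp
  then have "(\<lambda>z. z t) \<in> step_space \<gamma> \<rightarrow>\<^sub>M count_space UNIV"
    by (simp cong: measurable_cong_sets)
  \<comment> \<open>The step \<open>z t\<close> takes countably many values, so measurability may be
    checked with its value \<open>s\<close> frozen.\<close>
  then have "(\<lambda>z. (\<lambda>s z. s + walk g z t) (z t) z) \<in> step_space \<gamma> \<rightarrow>\<^sub>M count_space UNIV"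
    by (rule measurable_compose_countable[rotated]) (rule measurable_compose[OF Suc], simp)
  then show ?case by simp
qed simp

lemma sets_visible:
  "{z. visible f bs g z} \<in> sets (step_space (\<gamma> :: 'a::{group_add,finite} pmf))"
proof -
  have "{z. f (walk g z t)} \<in> sets (step_space \<gamma>)" for t
    using measurable_sets[OF measurable_walk[of g t \<gamma>], of "{x. f x}"]
    by (simp add: vimage_def)
  then have "{z \<in> space (step_space \<gamma>). \<forall>t\<in>{..<length bs}. bs ! t \<longrightarrow> f (walk g z t)} \<in> sets (step_space \<gamma>)"
    by (intro sets.sets_Collect_finite_All sets.sets_Collect_imp)
      (use sets.top[of "step_space \<gamma>"] in auto)
  then show ?thesis
    by (simp add: visible_def Ball_def)
qed

section \<open>Recursion on the first step\<close>

interpretation step: prob_space "step_space \<gamma>" for \<gamma>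
  by (rule prob_space_PiM) (rule prob_space_measure_pmf)

lemma measure_pair_pmf_finite:
  fixes p :: "'a::finite pmf"
  assumes "prob_space N" "space N = UNIV" and sets: "\<And>s. {z. P s z} \<in> sets N"
  shows "{(s, z). P s z} \<in> sets (measure_pmf p \<Otimes>\<^sub>M N)"
    and "measure (measure_pmf p \<Otimes>\<^sub>M N) {(s, z). P s z} = (\<Sum>s\<in>UNIV. pmf p s * measure N {z. P s z})"
proof -
  interpret N: prob_space N by fact
  interpret P: pair_prob_space "measure_pmf p" N ..
  have "{(s, z). P s z} = (\<Union>s. {s} \<times> {z. P s z})" by auto
  also have "\<dots> \<in> sets (measure_pmf p \<Otimes>\<^sub>M N)"
    by (intro sets.finite_UN) (auto intro: sets)
  finally show S: "{(s, z). P s z} \<in> sets (measure_pmf p \<Otimes>\<^sub>M N)" .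
  have "emeasure (measure_pmf p \<Otimes>\<^sub>M N) {(s, z). P s z} = (\<integral>\<^sup>+ s. emeasure N {z. P s z} \<partial>measure_pmf p)"
    using S by (subst N.emeasure_pair_measure_alt) (auto simp: vimage_def)
  also have "\<dots> = (\<Sum>s\<in>UNIV. emeasure N {z. P s z} * ennreal (pmf p s))"
    by (subst nn_integral_measure_pmf_support[of UNIV]) auto
  also have "\<dots> = ennreal (\<Sum>s\<in>UNIV. pmf p s * measure N {z. P s z})"
    by (subst sum_ennreal[symmetric]) (auto simp: N.emeasure_eq_measure ennreal_mult mult.commute)
  finally show "measure (measure_pmf p \<Otimes>\<^sub>M N) {(s, z). P s z} = (\<Sum>s\<in>UNIV. pmf p s * measure N {z. P s z})"
    by (simp add: measure_def sum_nonneg)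
qed

lemma visible_prob_Nil: "visible_prob \<gamma> f [] g = 1"
  using step.prob_space[of \<gamma>] by (simp add: visible_prob_def visible_def)

text \<open>Prepending an independent step to an i.i.d. sequence reproduces its law
  (\<open>PiM_iter\<close>), so one may condition on the first step.\<close>

lemma visible_prob_Cons:
  "visible_prob \<gamma> f (b # bs) g
    = of_bool (b \<longrightarrow> f g) * (\<Sum>s\<in>UNIV. pmf \<gamma> s * visible_prob \<gamma> f bs (s + g))"
proof -
  interpret sequence_space "measure_pmf \<gamma>" ..
  let ?A = "{z. visible f (b # bs) g z}"
  have "visible_prob \<gamma> f (b # bs) g
      = measure (distr (measure_pmf \<gamma> \<Otimes>\<^sub>M step_space \<gamma>) (step_space \<gamma>) (\<lambda>(s, z). case_nat s z)) ?A"
    unfolding PiM_iter visible_prob_def ..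
  also have "\<dots> = measure (measure_pmf \<gamma> \<Otimes>\<^sub>M step_space \<gamma>)
      {(s, z). (b \<longrightarrow> f g) \<and> visible f bs (s + g) z}"
    by (subst measure_distr) (auto simp: sets_visible space_pair_measure visible_Cons_case_nat
        intro!: arg_cong[of _ _ "measure _"])
  also have "\<dots> = (\<Sum>s\<in>UNIV. pmf \<gamma> s * measure (step_space \<gamma>) {z. (b \<longrightarrow> f g) \<and> visible f bs (s + g) z})"
  proof (intro measure_pair_pmf_finite(2))
    show "{z. (b \<longrightarrow> f g) \<and> visible f bs (s + g) z} \<in> sets (step_space \<gamma>)" for s
      using sets_visible by (cases "b \<longrightarrow> f g") auto
  qed (auto intro: step.prob_space_axioms)
  finally show ?thesis
    by (auto simp: visible_prob_def)
qed

lemma visible_prob_False: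
  "visible_prob \<gamma> f (replicate k False @ bs) g
    = (\<Sum>s\<in>UNIV. step_pow \<gamma> k s * visible_prob \<gamma> f bs (s + g))"
proof (induction k arbitrary: g)
  case 0
  then show ?case
    using sum_step_pow_0[of \<gamma> "\<lambda>s. visible_prob \<gamma> f bs (s + g)"] by (simp del: step_pow.simps)
next
  case (Suc k)
  then show ?case
    using sum_step_pow_Suc[of \<gamma> k "\<lambda>s. visible_prob \<gamma> f bs (s + g)"]
    by (simp add: visible_prob_Cons add.assoc del: step_pow.simps)
qed

text \<open>Each entry \<^term>\<open>l\<close> is the number of steps until the next observation; it must be positive,
  since \<^term>\<open>l - 1\<close> truncates.\<close>

fun pattern :: "nat list \<Rightarrow> bool list" where
  "pattern [] = [True]"
| "pattern (l # ls) = True # replicate (l - 1) False @ pattern ls"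

lemma visible_prob_pattern:
  assumes "0 \<notin> set ls"
  shows "visible_prob \<gamma> f (pattern ls) g = correlation f (map (step_pow \<gamma>) ls) g"
  using assms
proof (induction ls arbitrary: g)
  case Nil
  have "(\<Sum>s\<in>UNIV. pmf \<gamma> s) = 1"
    by (rule sum_pmf_eq_1) auto
  then show ?case
    by (simp add: visible_prob_Cons visible_prob_Nil)
next
  case (Cons l ls)
  then obtain m where "l = Suc m"
    by (cases l) auto
  \<comment> \<open>The observed time itself also accounts for one step: with its mark changed to
    \<open>False\<close> there are \<open>Suc m\<close> unobserved times, and only the factor for
    \<open>f g\<close> is lost.\<close>
  have "visible_prob \<gamma> f (False # replicate m False @ pattern ls) g
     = (\<Sum>s\<in>UNIV. step_pow \<gamma> (Suc m) s * visible_prob \<gamma> f (pattern ls) (s + g))"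
    using visible_prob_False[of \<gamma> f "Suc m" "pattern ls" g] by simp
  with Cons \<open>l = Suc m\<close> show ?case
    by (simp add: visible_prob_Cons del: step_pow.simps)
qed

section \<open>Cylinder probabilities of the observed scenery\<close>

lemma measure_scenery_law:
  fixes \<gamma> :: "'a::{group_add,finite} pmf"
  shows "measure (scenery_law \<gamma> f) {\<omega>. \<forall>t<length bs. bs ! t \<longrightarrow> \<omega> t}
    = (\<Sum>g\<in>UNIV. visible_prob \<gamma> f bs g) / CARD('a)"
proof -
  let ?N = "\<Pi>\<^sub>M i\<in>(UNIV::nat set). count_space (UNIV::bool set)"
  let ?F = "\<lambda>(g, z) t. f (walk g z t)"
  have fst: "fst \<in> walk_space \<gamma> \<rightarrow>\<^sub>M count_space (UNIV :: 'a set)"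
    unfolding walk_space_def using measurable_fst by (simp cong: measurable_cong_sets)
  have "(\<lambda>p. f (walk (fst p) (snd p) t)) \<in> walk_space \<gamma> \<rightarrow>\<^sub>M count_space UNIV" for t
  \<comment> \<open>The starting point is discrete as well and can be frozen.\<close>
  proof (rule measurable_compose_countable[OF _ fst])
    fix g :: 'a
    have "(\<lambda>z. f (walk g z t)) \<in> step_space \<gamma> \<rightarrow>\<^sub>M count_space UNIV"
      by (rule measurable_compose[OF measurable_walk]) simp
    then show "(\<lambda>p. f (walk g (snd p) t)) \<in> walk_space \<gamma> \<rightarrow>\<^sub>M count_space UNIV"
      unfolding walk_space_def by (rule measurable_compose[OF measurable_snd])
  qed
  then have F: "?F \<in> walk_space \<gamma> \<rightarrow>\<^sub>M ?N"
    by (intro measurable_PiM_single') (auto simp: case_prod_unfold space_PiM)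
  have "{\<omega> \<in> space ?N. \<forall>t\<in>{..<length bs}. bs ! t \<longrightarrow> \<omega> t} \<in> sets ?N"
  proof (intro sets.sets_Collect_finite_All sets.sets_Collect_imp)
    fix t
    show "{\<omega> \<in> space ?N. \<omega> t} \<in> sets ?N"
      using measurable_sets[OF measurable_component_singleton[of t UNIV "\<lambda>_. count_space (UNIV::bool set)"], of "{True}"]
      by (simp add: vimage_def Int_def conj_commute)
  qed auto
  then have "{\<omega>. \<forall>t<length bs. bs ! t \<longrightarrow> \<omega> t} \<in> sets ?N"
    by (simp add: space_PiM Ball_def)
  then have "measure (scenery_law \<gamma> f) {\<omega>. \<forall>t<length bs. bs ! t \<longrightarrow> \<omega> t}
      = measure (walk_space \<gamma>) {(g, z). visible f bs g z}"
    unfolding scenery_law_def using F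
    by (subst measure_distr) (auto simp: walk_space_def space_pair_measure visible_def
        intro!: arg_cong[of _ _ "measure _"])
  also have "\<dots> = (\<Sum>g\<in>UNIV. pmf (pmf_of_set UNIV) g * visible_prob \<gamma> f bs g)"
    unfolding walk_space_def visible_prob_def using sets_visible
    by (intro measure_pair_pmf_finite(2)) (auto intro: step.prob_space_axioms)
  also have "\<dots> = (\<Sum>g\<in>UNIV. visible_prob \<gamma> f bs g) / CARD('a)"
    by (simp add: sum_divide_distrib)
  finally show ?thesis .
qed

lemma scenery_law_eq_imp_correlation_eq:
  fixes \<gamma> :: "'a::{group_add,finite} pmf"
  assumes law: "scenery_law \<gamma> f1 = scenery_law \<gamma> f2" and ls: "0 \<notin> set ls"
  shows "(\<Sum>g\<in>UNIV. correlation f1 (map (step_pow \<gamma>) ls) g)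
    = (\<Sum>g\<in>UNIV. correlation f2 (map (step_pow \<gamma>) ls) g)"
proof -
  have "(\<Sum>g\<in>UNIV. visible_prob \<gamma> f1 (pattern ls) g) / CARD('a)
      = (\<Sum>g\<in>UNIV. visible_prob \<gamma> f2 (pattern ls) g) / CARD('a)"
    by (simp only: law flip: measure_scenery_law)
  then show ?thesis
    by (simp add: visible_prob_pattern[OF ls])
qed

theorem theorem1:
  fixes \<gamma> :: "'a::{group_add,finite} pmf"
    and R :: "('a \<Rightarrow> complex mat) set"
  assumes "complete_irreps R"
    and "fourier_condition \<gamma> R"
  shows "reconstructive \<gamma>"
  unfolding reconstructive_def
proof (intro allI impI)
  fix f1 f2 :: "'a \<Rightarrow> bool"
  assume law: "scenery_law \<gamma> f1 = scenery_law \<gamma> f2"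
  have rep: "is_rep \<rho>" if "\<rho> \<in> R" for \<rho>
    using assms(1) that unfolding complete_irreps_def irreducible_rep_def by blast
  \<comment> \<open>Positive exponents are those in the Fourier condition and also those that an
    observation pattern realises.\<close>
  let ?W = "step_pow \<gamma> ` {0<..}"
  have "(\<Sum>g\<in>UNIV. correlation f1 (map point_weight xs @ []) g)
      = (\<Sum>g\<in>UNIV. correlation f2 (map point_weight xs @ []) g)" for xs
  proof (rule correlation_point_weights[of ?W])
    show "u = (\<lambda>_. 0)" if "\<And>w. w \<in> ?W \<Longrightarrow> (\<Sum>s\<in>UNIV. w s * u s) = 0" for u
      using step_pow_separating[OF rep assms(2), of u] that by fastforce
    show "(\<Sum>g\<in>UNIV. correlation f1 ws g) = (\<Sum>g\<in>UNIV. correlation f2 ws g)" if "set ws \<subseteq> ?W" for ws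
    proof -
      have "ws \<in> lists ?W"
        using that by auto
      then obtain ls where "ws = map (step_pow \<gamma>) ls" "set ls \<subseteq> {0<..}"
        unfolding lists_image by auto
      then show ?thesis
        using scenery_law_eq_imp_correlation_eq[OF law, of ls] by auto
    qed
  qed simp
  then have eq: "(\<Sum>g\<in>UNIV. correlation f1 (map point_weight xs) g)
      = (\<Sum>g\<in>UNIV. correlation f2 (map point_weight xs) g)" for xs
    by simp
  \<comment> \<open>The equality of correlations is symmetric in the two sceneries, so each support
    has a translate inside the other.\<close>
  show "is_shift f1 f2"
    using correlation_imp_translate[of f1 f2] correlation_imp_translate[of f2 f1]
      is_shift_of_translates[of f1 f2] eq by metis
qed

end
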